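(* Let $G,\psi,x_c$ be as in the context, let $\ell\ge 0$ be an integer, let $x_i\in(0,x_c)$, and let $$0\le\kappa<\min\Big\{1,\frac{1-x_c^2G'(x_c)}{2}\Big\}.$$ Let $f,g\in C_0^\infty(\mathbb{R})$ and let $\tilde\phi\in C^\infty([x_i,x_c)\times\mathbb{R})$ be the unique solution of the wave equation $(W_\kappa)$ of the context with $\tilde\phi|_{x=x_i}=f$, $\tilde\phi_{,x}|_{x=x_i}=g$. Then $\tilde\phi$ is bounded on $[x_i,x_c]\times\mathbb{R}$.
   Context: Background. A spherically symmetric self-similar spacetime has line element $ds^2=-2Ge^{\psi}dv^2+2e^{\psi}dv\,dr+r^2d\Omega^2$ with $G=G(x)$, $\psi=\psi(x)$, $x=v/r$; put $\rho=\ln r$. Standing assumptions: there is a smallest positive root $x_c$ of $xG(x)-1=0$ (the Cauchy horizon is $x=x_c$); $G,\psi$ are real-analytic on $(-\infty,x_c]$; $x\psi'\le 0$ and $G'-\psi'(1-xG)G\le 0$ (null energy condition); $G>0$ on $(-\infty,x_c]$; $G'<0$ on $(0,x_c)$; $G'(x_c)<0$; and $1+x_c^2G'(x_c)>0$. Primes on functions of $x$ alone denote $d/dx$; commas denote partial derivatives. Equation. Put $\alpha(x)=-2x(1-xG)$, $\beta(x)=1-2xG$, $\gamma(x)=2G$ (so $\alpha<0$ on $(0,x_c)$ and $\alpha(x_c)=0$). If $\phi(x,\rho)$ is the $(\ell,m)$ spherical-harmonic multipole of a minimally coupled massless scalar field on this background, then $\tilde\phi=e^{\kappa\rho}\phi$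 satisfies $$(W_\kappa)\quad \alpha\tilde\phi_{,xx}+2\beta\tilde\phi_{,x\rho}+\gamma\tilde\phi_{,\rho\rho}+(\alpha'+2(1-\kappa)\beta)\tilde\phi_{,x}+(\beta'+2(1-\kappa)\gamma)\tilde\phi_{,\rho}+\big[(\kappa^2-2\kappa)\gamma-\kappa\beta'-\ell(\ell+1)e^{\psi}\big]\tilde\phi=0 .$$ For $f,g\in C_0^\infty(\mathbb{R})$ (smooth, compactly supported) and $x_i\in(0,x_c)$, the initial value problem for $(W_\kappa)$ with $\tilde\phi|_{x=x_i}=f$, $\tilde\phi_{,x}|_{x=x_i}=g$ has a unique solution in $C^\infty([x_i,x_c)\times\mathbb{R})$, and $\tilde\phi(x,\cdot)$ has compact support for each $x\in[x_i,x_c)$ (standard theory of linear symmetric hyperbolic systems). The value $\tilde\phi(x_c,\rho)$ is understood as the limit of $\tilde\phi(x,\rho)$ as $x\to x_c^-$. *)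

theory Defs
  imports "HOL-Analysis.Analysis"
begin

(* Analytic at a point means given by a convergent power series on a full neighbourhood of it,
   as for analytic_on over the complex numbers. On a closed half-line {..c} this is the usual
   convention: f has an analytic extension past c. Hence the two-sided derivative deriv f c
   is the one-sided derivative of f at c. *)
definition real_analytic_on :: "(real \<Rightarrow> real) \<Rightarrow> real set \<Rightarrow> bool" where
  "real_analytic_on f S \<longleftrightarrow> (\<forall>a\<in>S. \<exists>F. (\<lambda>h. f (a + h)) has_fps_expansion F)"

(* Derivatives are taken within S, so that C^k makes sense up to boundary points lying in S.
   They are unique for the sets used below: all of R, and I x R for an interval I. *)
primrec C_k_on :: "nat \<Rightarrow> ('a::real_normed_vector \<Rightarrow> 'b::real_normed_vector) \<Rightarrow> 'a set \<Rightarrow> bool" where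
  "C_k_on 0 f S \<longleftrightarrow> continuous_on S f"
| "C_k_on (Suc k) f S \<longleftrightarrow>
     (\<forall>x\<in>S. f differentiable (at x within S)) \<and>
     (\<forall>v. C_k_on k (\<lambda>x. frechet_derivative f (at x within S) v) S)"

definition smooth_on :: "('a::real_normed_vector \<Rightarrow> 'b::real_normed_vector) \<Rightarrow> 'a set \<Rightarrow> bool" where
  "smooth_on f S \<longleftrightarrow> (\<forall>k. C_k_on k f S)"

definition test_function :: "(real \<Rightarrow> real) \<Rightarrow> bool" where
  "test_function f \<longleftrightarrow> smooth_on f UNIV \<and> compact (closure {x. f x \<noteq> 0})"

(* Partial derivatives of u(x, rho), one-sided where the boundary of S requires it. *)
definition d_x :: "(real \<times> real) set \<Rightarrow> (real \<times> real \<Rightarrow> real) \<Rightarrow> real \<times> real \<Rightarrow> real" where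
  "d_x S u p = vector_derivative (\<lambda>s. u (s, snd p)) (at (fst p) within {s. (s, snd p) \<in> S})"

definition d_rho :: "(real \<times> real) set \<Rightarrow> (real \<times> real \<Rightarrow> real) \<Rightarrow> real \<times> real \<Rightarrow> real" where
  "d_rho S u p = vector_derivative (\<lambda>s. u (fst p, s)) (at (snd p) within {s. (fst p, s) \<in> S})"

definition alpha :: "(real \<Rightarrow> real) \<Rightarrow> real \<Rightarrow> real" where
  "alpha G x = - 2 * x * (1 - x * G x)"

definition beta :: "(real \<Rightarrow> real) \<Rightarrow> real \<Rightarrow> real" where
  "beta G x = 1 - 2 * x * G x"

definition gamma :: "(real \<Rightarrow> real) \<Rightarrow> real \<Rightarrow> real" where
  "gamma G x = 2 * G x"

(* The wave equation for the multipole of order l, after rescaling by exp (kappa * rho). *)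
definition wave_equation_on ::
  "(real \<times> real) set \<Rightarrow> (real \<Rightarrow> real) \<Rightarrow> (real \<Rightarrow> real) \<Rightarrow> nat \<Rightarrow> real \<Rightarrow> (real \<times> real \<Rightarrow> real) \<Rightarrow> bool"
  where
  "wave_equation_on S G \<psi> l \<kappa> \<phi> \<longleftrightarrow>
     (\<forall>(x, \<rho>)\<in>S.
        alpha G x * d_x S (d_x S \<phi>) (x, \<rho>)
      + 2 * beta G x * d_rho S (d_x S \<phi>) (x, \<rho>)
      + gamma G x * d_rho S (d_rho S \<phi>) (x, \<rho>)
      + (deriv (alpha G) x + 2 * (1 - \<kappa>) * beta G x) * d_x S \<phi> (x, \<rho>)
      + (deriv (beta G) x + 2 * (1 - \<kappa>) * gamma G x) * d_rho S \<phi> (x, \<rho>)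
      + ((\<kappa>\<^sup>2 - 2 * \<kappa>) * gamma G x - \<kappa> * deriv (beta G) x
          - real l * (real l + 1) * exp (\<psi> x)) * \<phi> (x, \<rho>) = 0)"

end

theory Submission
  imports Defs
begin

text \<open>
  Put a = 1 - kappa > 0 and d = 1 - x G, and let w = d (x phi_x - phi_rho - a phi). In 1+1 dimensions
  the wave equation is the first-order system
  phi' = (a / x) phi + w / (x d) along the ingoing direction (1, -1/x), and
  w' = -(a G / d) w + q phi along the outgoing direction (1, G / d), with q bounded up to x_c.
  Write y = x_c - x. By the hypotheses on G'(x_c), d is comparable to y, so the damping rate a G / d is
  at least A / y for some A in (0, 1], and w is forced to decay like a positive power of y; then w / d is
  integrable up to y = 0 and phi stays bounded.
  The pointwise form of this is a comparison with the supersolution |phi| < B, |w| < N y^delta B,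
  where delta = A / 2 and B = M exp (((a + 1) / x_i) x - (N / (x_i c delta)) y^delta), d >= c y, which is
  bounded. Since |phi'| <= B' along the ingoing lines, on which phi is thus uniformly Cauchy, the limit
  at x_c exists.
\<close>

subsection \<open>Analytic and smooth functions\<close>

text \<open>Near \<open>a\<close> the function is a power series, which can be differentiated
  termwise inside its disc of convergence, so \<open>deriv f\<close> agrees near \<open>a\<close>
  with the series of the formal derivative. The neighbourhood may leave \<open>S\<close>; this
  yields two-sided information at the horizon, the endpoint of the half-line.\<close>

lemma real_analytic_on_C1:
  assumes "real_analytic_on f S" "a \<in> S"
  shows "(f has_real_derivative deriv f a) (at a)" "isCont (deriv f) a"
proof -
  obtain F where F: "(\<lambda>h. f (a + h)) has_fps_expansion F"
    using assms unfolding real_analytic_on_def by blast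
  define R where "R = fps_conv_radius F"
  have R: "R > 0" using F by (simp add: has_fps_expansion_def R_def)
  have ev: "eventually (\<lambda>h. eval_fps F h = f (a + h)) (nhds 0)"
    using F by (simp add: has_fps_expansion_def)
  have "eventually (\<lambda>h::real. h \<in> eball 0 R) (nhds 0)"
    using R by (intro eventually_nhds_in_open) (auto simp: zero_ereal_def)
  with ev have "eventually (\<lambda>h. eval_fps F h = f (a + h) \<and> h \<in> eball 0 R) (nhds 0)"
    by eventually_elim auto
  then obtain U where U: "open U" "0 \<in> U" "\<And>h. h \<in> U \<Longrightarrow> eval_fps F h = f (a + h) \<and> h \<in> eball 0 R"
    unfolding eventually_nhds by blast
  define V where "V = (\<lambda>x. x - a) -` U"
  have V: "open V" "a \<in> V"
    unfolding V_def using U by (auto intro!: open_vimage continuous_intros)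
  have der: "(f has_real_derivative eval_fps (fps_deriv F) (x - a)) (at x)" if "x \<in> V" for x
  proof -
    have "(eval_fps F has_field_derivative eval_fps (fps_deriv F) (x - a)) (at (x - a))"
      using that U(3)[of "x - a"] by (intro has_field_derivative_eval_fps) (auto simp: V_def R_def in_eball_iff)
    then have "((\<lambda>x. eval_fps F (x - a)) has_field_derivative eval_fps (fps_deriv F) (x - a) * 1) (at x)"
      by (rule DERIV_chain2) (auto intro!: derivative_eq_intros)
    then have "((\<lambda>x. eval_fps F (x - a)) has_field_derivative eval_fps (fps_deriv F) (x - a)) (at x)"
      by simp
    then show ?thesis
      by (rule has_field_derivative_transform_within_open[OF _ V(1) that]) (use U(3) in \<open>auto simp: V_def\<close>)
  qed
  then have eq: "deriv f x = eval_fps (fps_deriv F) (x - a)" if "x \<in> V" for x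
    using that by (intro DERIV_imp_deriv) auto
  show "(f has_real_derivative deriv f a) (at a)"
    using der[OF V(2)] eq[OF V(2)] by simp
  have "norm (0::real) < fps_conv_radius (fps_deriv F)"
    using R fps_conv_radius_deriv[of F] by (simp add: R_def zero_ereal_def less_le_trans)
  then have "isCont (eval_fps (fps_deriv F)) (a - a)"
    by (intro continuous_eval_fps) simp
  then have "isCont (\<lambda>x. eval_fps (fps_deriv F) (x - a)) a"
    by (rule isCont_o2[where f="\<lambda>x. x - a", rotated]) simp
  moreover have "eventually (\<lambda>x. eval_fps (fps_deriv F) (x - a) = deriv f x) (nhds a)"
    using eventually_nhds_in_open[OF V] eq by (auto elim!: eventually_mono)
  ultimately show "isCont (deriv f) a"
    using isCont_cong by fast
qed

text \<open>The mean value theorem is applied twice: in the first variable to the increment of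
  \<open>F\<close> over the second, then in the second variable to \<open>F\<^sub>1\<close>. The
  left-hand side is symmetric in the two variables, which makes it useful for comparing mixed
  derivatives.\<close>

lemma second_difference_mean_value:
  fixes F F\<^sub>1 F\<^sub>1\<^sub>2 :: "real \<Rightarrow> real \<Rightarrow> real"
  assumes "h > 0"
    and 1: "\<And>s t. s \<in> {x..x+h} \<Longrightarrow> t \<in> {y..y+h} \<Longrightarrow> ((\<lambda>s. F s t) has_real_derivative F\<^sub>1 s t) (at s)"
    and 2: "\<And>s t. s \<in> {x..x+h} \<Longrightarrow> t \<in> {y..y+h} \<Longrightarrow> (F\<^sub>1 s has_real_derivative F\<^sub>1\<^sub>2 s t) (at t)"
  shows "\<exists>s\<in>{x..x+h}. \<exists>t\<in>{y..y+h}.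
           F (x + h) (y + h) - F (x + h) y - F x (y + h) + F x y = h * (h * F\<^sub>1\<^sub>2 s t)"
proof -
  have "\<exists>s. x < s \<and> s < x + h \<and>
     (F (x + h) (y + h) - F (x + h) y) - (F x (y + h) - F x y) = (x + h - x) * (F\<^sub>1 s (y + h) - F\<^sub>1 s y)"
    by (rule MVT2) (use \<open>h > 0\<close> in \<open>auto intro!: derivative_eq_intros 1\<close>)
  then obtain s where s: "x < s" "s < x + h"
     "(F (x + h) (y + h) - F (x + h) y) - (F x (y + h) - F x y) = h * (F\<^sub>1 s (y + h) - F\<^sub>1 s y)"
    by auto
  have "\<exists>t. y < t \<and> t < y + h \<and> F\<^sub>1 s (y + h) - F\<^sub>1 s y = (y + h - y) * F\<^sub>1\<^sub>2 s t"
    by (rule MVT2) (use \<open>h > 0\<close> s in \<open>auto intro!: 2\<close>)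
  then obtain t where "y < t" "t < y + h" "F\<^sub>1 s (y + h) - F\<^sub>1 s y = h * F\<^sub>1\<^sub>2 s t"
    by auto
  with s show ?thesis by (intro bexI[of _ s] bexI[of _ t]) auto
qed

lemma has_derivative_slices:
  fixes f :: "real \<times> real \<Rightarrow> real"
  assumes "(f has_derivative D) (at (x, y))"
  shows "((\<lambda>s. f (s, y)) has_real_derivative D (1, 0)) (at x)"
    and "((\<lambda>t. f (x, t)) has_real_derivative D (0, 1)) (at y)"
proof -
  have lin: "linear D" using assms has_derivative_linear by blast
  have "((\<lambda>s. f (s, y)) has_derivative (\<lambda>h. D (h, 0))) (at x)"
    by (rule has_derivative_compose[where g=f and f="\<lambda>s. (s, y)"])
       (use assms in \<open>auto intro!: derivative_eq_intros\<close>)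
  moreover have "(\<lambda>h. D (h, 0)) = (\<lambda>h. D (1, 0) * h)"
  proof
    fix h show "D (h, 0) = D (1, 0) * h"
      using linear_scale[OF lin, of h "(1, 0)"] by simp
  qed
  ultimately show "((\<lambda>s. f (s, y)) has_real_derivative D (1, 0)) (at x)"
    unfolding has_field_derivative_def by metis
  have "((\<lambda>t. f (x, t)) has_derivative (\<lambda>h. D (0, h))) (at y)"
    by (rule has_derivative_compose[where g=f and f="\<lambda>t. (x, t)"])
       (use assms in \<open>auto intro!: derivative_eq_intros\<close>)
  moreover have "(\<lambda>h. D (0, h)) = (\<lambda>h. D (0, 1) * h)"
  proof
    fix h show "D (0, h) = D (0, 1) * h"
      using linear_scale[OF lin, of h "(0, 1)"] by simp
  qed
  ultimately show "((\<lambda>t. f (x, t)) has_real_derivative D (0, 1)) (at y)"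
    unfolding has_field_derivative_def by metis
qed

text \<open>Reading the second difference over one small square in both orders gives equal values of
  \<open>f\<^sub>1\<^sub>2\<close> and \<open>f\<^sub>2\<^sub>1\<close> at two points of the square.
  Both points are close to \<open>p\<close>, so continuity at \<open>p\<close> closes the
  gap.\<close>

lemma mixed_partials_commute:
  fixes f :: "real \<times> real \<Rightarrow> real"
  assumes "open U" "p \<in> U"
    and f: "\<And>q. q \<in> U \<Longrightarrow> (f has_derivative (\<lambda>h. fst h * f\<^sub>1 q + snd h * f\<^sub>2 q)) (at q)"
    and f1: "\<And>q. q \<in> U \<Longrightarrow> (f\<^sub>1 has_derivative (\<lambda>h. fst h * f\<^sub>1\<^sub>1 q + snd h * f\<^sub>1\<^sub>2 q)) (at q)"
    and f2: "\<And>q. q \<in> U \<Longrightarrow> (f\<^sub>2 has_derivative (\<lambda>h. fst h * f\<^sub>2\<^sub>1 q + snd h * f\<^sub>2\<^sub>2 q)) (at q)"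
    and cont: "isCont f\<^sub>1\<^sub>2 p" "isCont f\<^sub>2\<^sub>1 p"
  shows "f\<^sub>1\<^sub>2 p = f\<^sub>2\<^sub>1 p"
proof -
  obtain x y where p: "p = (x, y)" by (cases p)
  have "dist (f\<^sub>1\<^sub>2 p) (f\<^sub>2\<^sub>1 p) < e" if "e > 0" for e
  proof -
    obtain d1 where d1: "d1 > 0" "\<And>q. dist q p < d1 \<Longrightarrow> dist (f\<^sub>1\<^sub>2 q) (f\<^sub>1\<^sub>2 p) < e/2"
      using cont(1) \<open>e > 0\<close> unfolding continuous_at_eps_delta by (metis half_gt_zero)
    obtain d2 where d2: "d2 > 0" "\<And>q. dist q p < d2 \<Longrightarrow> dist (f\<^sub>2\<^sub>1 q) (f\<^sub>2\<^sub>1 p) < e/2"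
      using cont(2) \<open>e > 0\<close> unfolding continuous_at_eps_delta by (metis half_gt_zero)
    obtain d3 where d3: "d3 > 0" "\<And>q. dist q p < d3 \<Longrightarrow> q \<in> U"
      using assms(1,2) unfolding open_dist by blast
    \<comment> \<open>Points of the square of side \<open>h\<close> have distance at most
      \<open>2 * h\<close> from its corner \<open>p\<close>; the third makes this less than all
      three radii.\<close>
    define h where "h = Min {d1, d2, d3} / 3"
    have h: "h > 0" "2 * h < d1" "2 * h < d2" "2 * h < d3"
      using d1(1) d2(1) d3(1) by (auto simp: h_def min_def)
    have near: "dist (s, t) p \<le> 2 * h" if "s \<in> {x..x+h}" "t \<in> {y..y+h}" for s t
    proof -
      have "dist (s, t) p \<le> dist s x + dist t y"
        unfolding p dist_Pair_Pair by (rule real_le_lsqrt) (auto simp: power2_sum)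
      also have "\<dots> \<le> 2 * h" using that by (auto simp: dist_real_def)
      finally show ?thesis .
    qed
    have inU: "(s, t) \<in> U" if "s \<in> {x..x+h}" "t \<in> {y..y+h}" for s t
      using near[OF that] h d3 by auto
    obtain s t where st: "s \<in> {x..x+h}" "t \<in> {y..y+h}"
      "f (x + h, y + h) - f (x + h, y) - f (x, y + h) + f (x, y) = h * (h * f\<^sub>1\<^sub>2 (s, t))"
      using second_difference_mean_value[OF h(1), of x y "\<lambda>s t. f (s, t)" "\<lambda>s t. f\<^sub>1 (s, t)" "\<lambda>s t. f\<^sub>1\<^sub>2 (s, t)"]
        has_derivative_slices(1)[OF f[OF inU]] has_derivative_slices(2)[OF f1[OF inU]] by auto
    obtain s' t' where st': "s' \<in> {x..x+h}" "t' \<in> {y..y+h}"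
      "f (x + h, y + h) - f (x, y + h) - f (x + h, y) + f (x, y) = h * (h * f\<^sub>2\<^sub>1 (s', t'))"
      using second_difference_mean_value[OF h(1), of y x "\<lambda>t s. f (s, t)" "\<lambda>t s. f\<^sub>2 (s, t)" "\<lambda>t s. f\<^sub>2\<^sub>1 (s, t)"]
        has_derivative_slices(2)[OF f[OF inU]] has_derivative_slices(1)[OF f2[OF inU]] by auto
    have "h * (h * f\<^sub>1\<^sub>2 (s, t)) = h * (h * f\<^sub>2\<^sub>1 (s', t'))"
      using st(3) st'(3) by linarith
    then have "f\<^sub>1\<^sub>2 (s, t) = f\<^sub>2\<^sub>1 (s', t')"
      using h(1) by simp
    moreover have "dist (f\<^sub>1\<^sub>2 (s, t)) (f\<^sub>1\<^sub>2 p) < e/2"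
      using near[OF st(1,2)] h by (intro d1(2)) auto
    moreover have "dist (f\<^sub>2\<^sub>1 (s', t')) (f\<^sub>2\<^sub>1 p) < e/2"
      using near[OF st'(1,2)] h by (intro d2(2)) auto
    ultimately show ?thesis by (metis dist_commute dist_triangle_half_r)
  qed
  then show ?thesis by (metis less_irrefl zero_less_dist_iff)
qed

section \<open>Smooth functions and their partial derivatives on a half-open strip\<close>

lemma smooth_on_imp_continuous_on: "smooth_on f S \<Longrightarrow> continuous_on S f"
  unfolding smooth_on_def by (metis C_k_on.simps(1))

lemma smooth_on_frechet_derivative:
  assumes "smooth_on f S"
  shows "smooth_on (\<lambda>x. frechet_derivative f (at x within S) v) S"
  using assms unfolding smooth_on_def by (metis C_k_on.simps(2))

lemma smooth_on_has_derivative: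
  assumes "smooth_on f S" "x \<in> S"
  shows "(f has_derivative frechet_derivative f (at x within S)) (at x within S)"
  using assms unfolding smooth_on_def by (metis C_k_on.simps(2) frechet_derivative_works)

text \<open>The components are the derivative in the directions \<open>(1, 0)\<close> and
  \<open>(0, 1)\<close>; they are smooth again because \<open>C_k_on\<close> descends in every fixed
  direction. Applied repeatedly, this names the second derivatives as ordinary functions.\<close>

lemma smooth_on_partials:
  fixes f :: "real \<times> real \<Rightarrow> real"
  assumes "smooth_on f S"
  obtains f\<^sub>1 f\<^sub>2 where "smooth_on f\<^sub>1 S" "smooth_on f\<^sub>2 S"
    "\<And>p. p \<in> S \<Longrightarrow> (f has_derivative (\<lambda>h. fst h * f\<^sub>1 p + snd h * f\<^sub>2 p)) (at p within S)"
proof -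
  let ?D = "\<lambda>p. frechet_derivative f (at p within S)"
  have "(f has_derivative (\<lambda>h. fst h * ?D p (1, 0) + snd h * ?D p (0, 1))) (at p within S)" if "p \<in> S" for p
  proof -
    have D: "(f has_derivative ?D p) (at p within S)"
      by (rule smooth_on_has_derivative[OF assms that])
    then have lin: "linear (?D p)" using has_derivative_linear by blast
    have "?D p = (\<lambda>h. fst h * ?D p (1, 0) + snd h * ?D p (0, 1))"
    proof
      fix h
      have "h = fst h *\<^sub>R (1, 0) + snd h *\<^sub>R (0, 1)" by (simp add: prod_eq_iff)
      then have "?D p h = ?D p (fst h *\<^sub>R (1, 0) + snd h *\<^sub>R (0, 1))" by simp
      also have "\<dots> = fst h * ?D p (1, 0) + snd h * ?D p (0, 1)"
        by (simp only: linear_add[OF lin] linear_scale[OF lin] real_scaleR_def)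
      finally show "?D p h = fst h * ?D p (1, 0) + snd h * ?D p (0, 1)" .
    qed
    then show ?thesis using D by metis
  qed
  then show thesis using that smooth_on_frechet_derivative[OF assms] by blast
qed

text \<open>This identifies \<open>d_x\<close> and \<open>d_rho\<close> with components of the
  derivative within the strip. Letting \<open>g\<close> agree with \<open>f\<close> on the strip
  only allows iteration: \<open>d_x S u\<close>, for instance, is known only there.\<close>

lemma
  fixes f g :: "real \<times> real \<Rightarrow> real"
  assumes "a < b" and p: "p \<in> {a..<b} \<times> UNIV"
    and D: "(f has_derivative D) (at p within {a..<b} \<times> UNIV)"
    and eq: "\<And>q. q \<in> {a..<b} \<times> UNIV \<Longrightarrow> g q = f q"
  shows d_x_strip: "d_x ({a..<b} \<times> UNIV) g p = D (1, 0)"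
    and d_rho_strip: "d_rho ({a..<b} \<times> UNIV) g p = D (0, 1)"
proof -
  obtain x y where xy: "p = (x, y)" "a \<le> x" "x < b" using p by auto
  have lin: "linear D" using D has_derivative_linear by blast
  have "((\<lambda>s. f (s, y)) has_derivative (\<lambda>h. D (h, 0))) (at x within {a..<b})"
    by (rule has_derivative_in_compose[where g=f and f="\<lambda>s. (s, y)" and g'=D])
       (use xy in \<open>auto intro!: derivative_eq_intros has_derivative_subset[OF D[unfolded xy(1)]]\<close>)
  moreover have "(\<lambda>h. D (h, 0)) = (\<lambda>h. h *\<^sub>R D (1, 0))"
  proof
    fix h show "D (h, 0) = h *\<^sub>R D (1, 0)"
      using linear_scale[OF lin, of h "(1, 0)"] by simp
  qed
  ultimately have "((\<lambda>s. f (s, y)) has_vector_derivative D (1, 0)) (at x within {a..<b})"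
    unfolding has_vector_derivative_def by metis
  then have "((\<lambda>s. g (s, y)) has_vector_derivative D (1, 0)) (at x within {a..<b})"
    by (rule has_vector_derivative_transform[rotated 2]) (use xy eq in simp_all)
  \<comment> \<open>Every point of the interval is a limit point of it, the left end included, so
    the one-sided derivative is unique.\<close>
  moreover have "at x within {a..<b} \<noteq> bot"
    using xy \<open>a < b\<close> by (simp add: trivial_limit_within islimpt_Ico)
  ultimately have "vector_derivative (\<lambda>s. g (s, y)) (at x within {a..<b}) = D (1, 0)"
    by (intro vector_derivative_within)
  then show "d_x ({a..<b} \<times> UNIV) g p = D (1, 0)"
    using xy by (simp add: d_x_def atLeastLessThan_def lessThan_def atLeast_def Int_def)
  have "((\<lambda>s. f (x, s)) has_derivative (\<lambda>h. D (0, h))) (at y within UNIV)"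
    by (rule has_derivative_in_compose[where g=f and f="\<lambda>s. (x, s)" and g'=D])
       (use xy in \<open>auto intro!: derivative_eq_intros has_derivative_subset[OF D[unfolded xy(1)]]\<close>)
  moreover have "(\<lambda>h. D (0, h)) = (\<lambda>h. h *\<^sub>R D (0, 1))"
  proof
    fix h show "D (0, h) = h *\<^sub>R D (0, 1)"
      using linear_scale[OF lin, of h "(0, 1)"] by simp
  qed
  ultimately have "((\<lambda>s. f (x, s)) has_vector_derivative D (0, 1)) (at y)"
    unfolding has_vector_derivative_def by metis
  moreover have "(\<lambda>s. g (x, s)) = (\<lambda>s. f (x, s))" using xy eq by auto
  ultimately have "vector_derivative (\<lambda>s. g (x, s)) (at y) = D (0, 1)"
    using vector_derivative_at by metis
  then show "d_rho ({a..<b} \<times> UNIV) g p = D (0, 1)"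
    using xy by (simp add: d_rho_def)
qed

lemma open_strip_at: "a < x \<Longrightarrow> x < b \<Longrightarrow> at (x, y) within ({a..<b} \<times> UNIV) = at (x :: real, y :: real)"
  by (rule at_within_open_subset[of _ "{a<..<b} \<times> UNIV"]) (auto intro: open_Times)

subsection \<open>The wave equation as a first-order system\<close>

text \<open>With \<open>D = 1 - x * G x\<close>, the second-order part of the equation factors as -2
  (D d/dx + G d/drho) (x d/dx - d/drho). Hence differentiating \<open>w\<close> along
  \<open>(1, G x / D)\<close> reproduces the second-order terms, and the equation trades them for
  lower-order ones. The weight \<open>D\<close> and the term with \<open>1 - \<kappa>\<close> inside
  \<open>w\<close> are such that only \<open>w\<close> and \<open>\<phi>\<close> remain.\<close>

lemma wave_equation_outgoing_transport:
  fixes G \<psi> :: "real \<Rightarrow> real" and \<phi> P R :: "real \<times> real \<Rightarrow> real" and x\<^sub>i x\<^sub>c \<kappa> x :: real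
  defines "S \<equiv> {x\<^sub>i..<x\<^sub>c} \<times> UNIV"
  assumes "x\<^sub>i < x\<^sub>c"
    and sm: "smooth_on \<phi> S" "smooth_on P S" "smooth_on R S"
    and \<phi>: "\<And>p. p \<in> S \<Longrightarrow> (\<phi> has_derivative (\<lambda>h. fst h * P p + snd h * R p)) (at p within S)"
    and wave: "wave_equation_on S G \<psi> l \<kappa> \<phi>"
    and x: "x\<^sub>i < x" "x < x\<^sub>c"
    and G: "(G has_real_derivative G') (at x)"
    and d: "1 - x * G x \<noteq> 0"
  defines "w \<equiv> \<lambda>p. (1 - fst p * G (fst p)) * (fst p * P p - R p - (1 - \<kappa>) * \<phi> p)"
  shows "\<exists>W. (w has_derivative W) (at (x, \<rho>)) \<and>
             W (1, G x / (1 - x * G x)) = - ((1 - \<kappa>) * G x / (1 - x * G x)) * w (x, \<rho>)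
                + (x * G' - real l * (real l + 1) * exp (\<psi> x) / 2) * \<phi> (x, \<rho>)"
proof -
  let ?I = "{x\<^sub>i<..<x\<^sub>c} \<times> (UNIV :: real set)"
  have open_I: "open ?I" by (intro open_Times) auto
  have at_I: "p \<in> S \<and> at p within S = at p" if "p \<in> ?I" for p
    using that open_strip_at[of x\<^sub>i "fst p" x\<^sub>c "snd p"] by (auto simp: S_def)
  obtain Px Pr where smP: "smooth_on Px S" "smooth_on Pr S"
    and P: "\<And>p. p \<in> S \<Longrightarrow> (P has_derivative (\<lambda>h. fst h * Px p + snd h * Pr p)) (at p within S)"
    using smooth_on_partials[OF sm(2)] by blast
  obtain Rx Rr where smR: "smooth_on Rx S" "smooth_on Rr S"
    and R: "\<And>p. p \<in> S \<Longrightarrow> (R has_derivative (\<lambda>h. fst h * Rx p + snd h * Rr p)) (at p within S)"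
    using smooth_on_partials[OF sm(3)] by blast
  define p where "p = (x, \<rho>)"
  have pI: "p \<in> ?I" using x by (simp add: p_def)
  have pS: "p \<in> S" using at_I pI by blast
  have \<phi>_at: "(\<phi> has_derivative (\<lambda>h. fst h * P p + snd h * R p)) (at p)" if "p \<in> ?I" for p
    using \<phi>[of p] at_I[OF that] by auto
  have P_at: "(P has_derivative (\<lambda>h. fst h * Px p + snd h * Pr p)) (at p)" if "p \<in> ?I" for p
    using P[of p] at_I[OF that] by auto
  have R_at: "(R has_derivative (\<lambda>h. fst h * Rx p + snd h * Rr p)) (at p)" if "p \<in> ?I" for p
    using R[of p] at_I[OF that] by auto
  \<comment> \<open>Differentiating \<open>w\<close> produces both mixed derivatives, while the
    equation contains only \<open>Pr\<close>; their symmetry is needed for the cancellation.\<close>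
  have "isCont Pr p" "isCont Rx p"
    using smooth_on_imp_continuous_on[OF smP(2)] smooth_on_imp_continuous_on[OF smR(1)] at_I[OF pI]
    unfolding continuous_on_eq_continuous_within by metis+
  then have sym: "Rx p = Pr p"
    using mixed_partials_commute[OF open_I pI \<phi>_at P_at R_at] by simp
  have d\<phi>: "d_x S \<phi> q = P q" "d_rho S \<phi> q = R q" if "q \<in> S" for q
    using d_x_strip[OF \<open>x\<^sub>i < x\<^sub>c\<close> _ \<phi>[unfolded S_def]] d_rho_strip[OF \<open>x\<^sub>i < x\<^sub>c\<close> _ \<phi>[unfolded S_def]] that
    by (simp_all add: S_def)
  have dP: "d_x S (d_x S \<phi>) p = Px p" "d_rho S (d_x S \<phi>) p = Pr p"
    using d_x_strip[OF \<open>x\<^sub>i < x\<^sub>c\<close> _ P[unfolded S_def], of p "d_x S \<phi>"]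
      d_rho_strip[OF \<open>x\<^sub>i < x\<^sub>c\<close> _ P[unfolded S_def], of p "d_x S \<phi>"] pS d\<phi>(1) by (simp_all add: S_def)
  have dR: "d_rho S (d_rho S \<phi>) p = Rr p"
    using d_rho_strip[OF \<open>x\<^sub>i < x\<^sub>c\<close> _ R[unfolded S_def], of p "d_rho S \<phi>"] pS d\<phi>(2) by (simp_all add: S_def)
  have \<alpha>': "deriv (alpha G) x = - 2 + 4 * x * G x + 2 * x * (x * G')"
    by (rule DERIV_imp_deriv)
       (use G in \<open>auto simp: alpha_def[abs_def] algebra_simps intro!: derivative_eq_intros\<close>)
  have \<beta>': "deriv (beta G) x = - 2 * G x - 2 * (x * G')"
    by (rule DERIV_imp_deriv)
       (use G in \<open>auto simp: beta_def[abs_def] algebra_simps intro!: derivative_eq_intros\<close>)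
  define D where "D = 1 - x * G x"
  have eq: "- 2 * x * (1 - x * G x) * Px p + 2 * (1 - 2 * x * G x) * Pr p + 2 * G x * Rr p
      + (- 2 + 4 * x * G x + 2 * x * (x * G') + 2 * (1 - \<kappa>) * (1 - 2 * x * G x)) * P p
      + (- 2 * G x - 2 * (x * G') + 2 * (1 - \<kappa>) * (2 * G x)) * R p
      + ((\<kappa>\<^sup>2 - 2 * \<kappa>) * (2 * G x) - \<kappa> * (- 2 * G x - 2 * (x * G')) - real l * (real l + 1) * exp (\<psi> x)) * \<phi> p = 0"
    using wave pS dP dR d\<phi>[OF pS] unfolding wave_equation_on_def p_def
    by (auto simp: \<alpha>' \<beta>' simp: alpha_def beta_def gamma_def)
  define W where "W = (\<lambda>h :: real \<times> real. - (fst h * G x + x * (fst h * G')) * (x * P p - R p - (1 - \<kappa>) * \<phi> p)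
     + D * (fst h * P p + x * (fst h * Px p + snd h * Pr p) - (fst h * Rx p + snd h * Rr p)
            - (1 - \<kappa>) * (fst h * P p + snd h * R p)))"
  have fst_der: "(fst has_derivative fst) (at p)" by (rule has_derivative_fst) (rule has_derivative_ident)
  have G_der: "((\<lambda>q. G (fst q)) has_derivative (\<lambda>h. fst h * G')) (at p)"
  proof (rule has_derivative_compose[of fst fst p UNIV G "\<lambda>h. h * G'"])
    show "(fst has_derivative fst) (at p)" by (rule fst_der)
    show "(G has_derivative (\<lambda>h. h * G')) (at (fst p))"
      using G by (simp add: has_field_derivative_def p_def mult.commute[of _ G'])
  qed
  have "(w has_derivative W) (at p)"
    unfolding w_def W_def D_def
    by (rule has_derivative_eq_rhs[OF has_derivative_mult[OF
          has_derivative_diff[OF has_derivative_const has_derivative_mult[OF fst_der G_der]]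
          has_derivative_diff[OF has_derivative_diff[OF has_derivative_mult[OF fst_der P_at[OF pI]] R_at[OF pI]]
            has_derivative_mult_right[OF \<phi>_at[OF pI]]]]])
       (simp add: p_def fun_eq_iff algebra_simps)
  moreover have "W (1, G x / D) = - ((1 - \<kappa>) * G x / D) * w p
        + (x * G' - real l * (real l + 1) * exp (\<psi> x) / 2) * \<phi> p"
  proof -
    \<comment> \<open>Once \<open>D * t = G x\<close> is recorded, the remaining identities are
      polynomial in \<open>t\<close> and need no division.\<close>
    define t where "t = G x / D"
    have t: "D * t = G x" using d by (simp add: t_def D_def)
    have "w p = D * (x * P p - R p - (1 - \<kappa>) * \<phi> p)" by (simp add: w_def p_def D_def)
    then have wt: "- ((1 - \<kappa>) * t) * w p = - (1 - \<kappa>) * G x * (x * P p - R p - (1 - \<kappa>) * \<phi> p)"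
      using t by algebra
    have "W (1, t) = - (G x + x * G') * (x * P p - R p - (1 - \<kappa>) * \<phi> p)
        + D * (P p + x * Px p - Pr p - (1 - \<kappa>) * P p) + G x * (x * Pr p - Rr p - (1 - \<kappa>) * R p)"
      using arg_cong[OF t, of "\<lambda>s. s * (x * Pr p - Rr p - (1 - \<kappa>) * R p)"]
      by (simp add: W_def sym algebra_simps)
    \<comment> \<open>The second-order terms of the doubled derivative are exactly the negatives of
      those in \<open>eq\<close>.\<close>
    also have "2 * \<dots> = 2 * (- (1 - \<kappa>) * G x * (x * P p - R p - (1 - \<kappa>) * \<phi> p)
        + (x * G' - real l * (real l + 1) * exp (\<psi> x) / 2) * \<phi> p)"
      using eq unfolding D_def by (simp add: field_simps power2_eq_square)
    finally show ?thesis using wt unfolding t_def by simp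
  qed
  ultimately show ?thesis unfolding p_def D_def by blast
qed

subsection \<open>Comparison along two speeds\<close>

text \<open>Going backwards from the contact point along \<open>(1, c)\<close>, the gap between
  \<open>B\<close> and the signed value of \<open>u\<close> is positive for small
  \<open>t > 0\<close> and zero at \<open>t = 0\<close>. Its one-sided derivative there, the
  difference of the two sides of the second claim, cannot be negative.\<close>

lemma first_contact_derivative:
  fixes u :: "real \<times> real \<Rightarrow> real"
  assumes u: "(u has_derivative D) (at (x, y))"
    and B: "(B has_real_derivative B') (at x)" "B x > 0"
    and contact: "B x \<le> \<bar>u (x, y)\<bar>"
    and before: "\<forall>\<^sub>F t in at_right 0. \<bar>u (x - t, y - t * c)\<bar> < B (x - t)"
  shows "\<bar>u (x, y)\<bar> = B x" and "B' \<le> sgn (u (x, y)) * D (1, c)"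
proof -
  \<comment> \<open>Freezing the sign replaces the absolute value by a differentiable function.
    Since \<open>B x > 0\<close>, the value at contact is nonzero and the sign is 1 or -1.\<close>
  define \<sigma> where "\<sigma> = sgn (u (x, y))"
  have \<sigma>: "\<bar>\<sigma>\<bar> = 1" "\<sigma> * u (x, y) = \<bar>u (x, y)\<bar>"
    using B(2) contact by (auto simp: \<sigma>_def sgn_if)
  have lin: "linear D" using u has_derivative_linear by blast
  define v where "v = (\<lambda>t. B (x - t) - \<sigma> * u (x - t, y - t * c))"
  have "((\<lambda>t. u (x - t, y - t * c)) has_derivative (\<lambda>h. D (- h, - (h * c)))) (at 0)"
    by (rule has_derivative_compose[where f="\<lambda>t. (x - t, y - t * c)" and g=u])
       (use u in \<open>auto intro!: derivative_eq_intros\<close>)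
  moreover have "(\<lambda>h. D (- h, - (h * c))) = (\<lambda>h. - D (1, c) * h)"
  proof
    fix h show "D (- h, - (h * c)) = - D (1, c) * h"
      using linear_scale[OF lin, of "- h" "(1, c)"] by simp
  qed
  ultimately have "((\<lambda>t. u (x - t, y - t * c)) has_real_derivative - D (1, c)) (at 0)"
    unfolding has_field_derivative_def by metis
  moreover have "((\<lambda>t. B (x - t)) has_real_derivative B' * (- 1)) (at 0)"
    by (rule DERIV_chain2[where f=B]) (use B(1) in \<open>auto intro!: derivative_eq_intros\<close>)
  ultimately have v: "(v has_real_derivative \<sigma> * D (1, c) - B') (at 0)"
    unfolding v_def by (auto intro!: derivative_eq_intros)
  have pos: "\<forall>\<^sub>F t in at_right 0. v t > 0"
    using before
  proof eventually_elim
    case (elim t)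
    have "\<sigma> * u (x - t, y - t * c) \<le> \<bar>\<sigma> * u (x - t, y - t * c)\<bar>" by (rule abs_ge_self)
    also have "\<dots> = \<bar>u (x - t, y - t * c)\<bar>" using \<sigma>(1) by (simp add: abs_mult)
    finally show ?case using elim by (simp add: v_def)
  qed
  have "(v \<longlongrightarrow> v 0) (at_right 0)"
    using DERIV_isCont[OF v] by (simp add: isCont_def filterlim_at_split)
  then have "v 0 \<ge> 0"
    by (rule tendsto_lowerbound) (use pos in \<open>auto elim: eventually_mono\<close>)
  moreover have "v 0 = B x - \<bar>u (x, y)\<bar>" using \<sigma>(2) by (simp add: v_def)
  ultimately show eq: "\<bar>u (x, y)\<bar> = B x" using contact by linarith
  show "B' \<le> sgn (u (x, y)) * D (1, c)"
  proof (rule ccontr)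
    assume "\<not> ?thesis"
    then have "\<sigma> * D (1, c) - B' < 0" by (simp add: \<sigma>_def)
    from DERIV_neg_dec_right[OF v this] obtain d where d: "d > 0" "\<And>h. 0 < h \<Longrightarrow> h < d \<Longrightarrow> v h < v 0"
      by auto
    have "\<forall>\<^sub>F t in at_right 0. 0 < t \<and> t < d"
      using d(1) by (simp add: eventually_at_right_field) (use d(1) in blast)
    with pos have "\<forall>\<^sub>F t in at_right (0::real). False"
      by eventually_elim (use d(2) eq \<open>v 0 = B x - \<bar>u (x, y)\<bar>\<close> in fastforce)
    then show False by simp
  qed
qed

text \<open>A contact point with smallest first coordinate is impossible: there the quantity in
  contact would have to grow along its own speed at least as fast as its barrier, against
  \<open>super_u\<close> or \<open>super_w\<close>. These are required only where one quantity
  touches its barrier and the other has not crossed its own, which is the situation at a first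
  contact. As \<open>y\<close> is unbounded, compactness comes from a backward domain of dependence
  of the given point.\<close>

lemma two_speed_comparison:
  fixes u w :: "real \<times> real \<Rightarrow> real" and c d B B' \<Omega> \<Omega>' :: "real \<Rightarrow> real"
  assumes cont: "continuous_on ({a..<b} \<times> UNIV) u" "continuous_on ({a..<b} \<times> UNIV) w"
      "continuous_on {a..<b} c" "continuous_on {a..<b} d"
      "continuous_on {a..<b} B" "continuous_on {a..<b} \<Omega>"
    and U: "\<And>x y. a < x \<Longrightarrow> x < b \<Longrightarrow> (u has_derivative U (x, y)) (at (x, y))"
    and W: "\<And>x y. a < x \<Longrightarrow> x < b \<Longrightarrow> (w has_derivative W (x, y)) (at (x, y))"
    and B: "\<And>x. a < x \<Longrightarrow> x < b \<Longrightarrow> (B has_real_derivative B' x) (at x)"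
    and \<Omega>: "\<And>x. a < x \<Longrightarrow> x < b \<Longrightarrow> (\<Omega> has_real_derivative \<Omega>' x) (at x)"
    and pos: "\<And>x. a < x \<Longrightarrow> x < b \<Longrightarrow> 0 < B x" "\<And>x. a < x \<Longrightarrow> x < b \<Longrightarrow> 0 < \<Omega> x"
    and init: "\<And>y. \<bar>u (a, y)\<bar> < B a" "\<And>y. \<bar>w (a, y)\<bar> < \<Omega> a"
    and super_u: "\<And>x y. a < x \<Longrightarrow> x < b \<Longrightarrow> \<bar>u (x, y)\<bar> = B x \<Longrightarrow> \<bar>w (x, y)\<bar> \<le> \<Omega> x
                    \<Longrightarrow> sgn (u (x, y)) * U (x, y) (1, c x) < B' x"
    and super_w: "\<And>x y. a < x \<Longrightarrow> x < b \<Longrightarrow> \<bar>w (x, y)\<bar> = \<Omega> x \<Longrightarrow> \<bar>u (x, y)\<bar> \<le> B x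
                    \<Longrightarrow> sgn (w (x, y)) * W (x, y) (1, d x) < \<Omega>' x"
    and x0: "a \<le> x\<^sub>0" "x\<^sub>0 < b"
  shows "\<bar>u (x\<^sub>0, y\<^sub>0)\<bar> < B x\<^sub>0 \<and> \<bar>w (x\<^sub>0, y\<^sub>0)\<bar> < \<Omega> x\<^sub>0"
proof (rule ccontr)
  assume neg: "\<not> ?thesis"
  have sub: "{a..x\<^sub>0} \<subseteq> {a..<b}" using x0 by auto
  obtain Kc where Kc: "\<And>x. x \<in> {a..x\<^sub>0} \<Longrightarrow> \<bar>c x\<bar> \<le> Kc"
    using compact_imp_bounded[OF compact_continuous_image[OF continuous_on_subset[OF cont(3) sub]]]
    unfolding bounded_iff by fastforce
  obtain Kd where Kd: "\<And>x. x \<in> {a..x\<^sub>0} \<Longrightarrow> \<bar>d x\<bar> \<le> Kd"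
    using compact_imp_bounded[OF compact_continuous_image[OF continuous_on_subset[OF cont(4) sub]]]
    unfolding bounded_iff by fastforce
  define K where "K = max Kc Kd"
  have K: "\<bar>c x\<bar> \<le> K" "\<bar>d x\<bar> \<le> K" if "x \<in> {a..x\<^sub>0}" for x
    using Kc[OF that] Kd[OF that] by (auto simp: K_def)
  \<comment> \<open>A trapezoid that cannot be left by going backwards along either speed, starting at any of its points.\<close>
  define T where "T = {(x, y). a \<le> x \<and> x \<le> x\<^sub>0 \<and> \<bar>y - y\<^sub>0\<bar> \<le> K * (x\<^sub>0 - x)}"
  have "K \<ge> 0" using K(1)[of a] x0 by (metis abs_ge_zero atLeastAtMost_iff order.trans order_refl)
  have T_sub: "T \<subseteq> {a..x\<^sub>0} \<times> {y\<^sub>0 - K * (x\<^sub>0 - a)..y\<^sub>0 + K * (x\<^sub>0 - a)}"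
  proof safe
    fix x y assume "(x, y) \<in> T"
    then have *: "a \<le> x" "x \<le> x\<^sub>0" "\<bar>y - y\<^sub>0\<bar> \<le> K * (x\<^sub>0 - x)" by (auto simp: T_def)
    moreover have "K * (x\<^sub>0 - x) \<le> K * (x\<^sub>0 - a)" using * \<open>K \<ge> 0\<close> by (intro mult_left_mono) auto
    ultimately show "x \<in> {a..x\<^sub>0}" "y \<in> {y\<^sub>0 - K * (x\<^sub>0 - a)..y\<^sub>0 + K * (x\<^sub>0 - a)}" by auto
  qed
  have "closed T"
    unfolding T_def case_prod_unfold by (intro closed_Collect_conj closed_Collect_le continuous_intros)
  moreover have "bounded T"
    by (rule bounded_subset[OF bounded_Times[OF bounded_closed_interval bounded_closed_interval] T_sub])
  ultimately have "compact T" by (simp add: compact_eq_bounded_closed)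
  have T_strip: "T \<subseteq> {a..<b} \<times> UNIV" using T_sub x0 by fastforce
  have fst_T: "fst ` T \<subseteq> {a..<b}" using T_strip by auto
  \<comment> \<open>The points of \<open>T\<close> at which a strict bound fails; closedness of this
    set is what lets a first one be chosen.\<close>
  define V where "V = {p \<in> T. B (fst p) \<le> \<bar>u p\<bar>} \<union> {p \<in> T. \<Omega> (fst p) \<le> \<bar>w p\<bar>}"
  have "closed {p \<in> T. B (fst p) \<le> \<bar>u p\<bar>}" "closed {p \<in> T. \<Omega> (fst p) \<le> \<bar>w p\<bar>}"
    by (intro continuous_on_closed_Collect_le \<open>closed T\<close> continuous_intros
          continuous_on_subset[OF cont(1) T_strip] continuous_on_subset[OF cont(2) T_strip]
          continuous_on_compose2[OF cont(5) _ fst_T] continuous_on_compose2[OF cont(6) _ fst_T])+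
  then have "closed V" unfolding V_def by (rule closed_Un)
  then have "compact (T \<inter> V)" by (rule compact_Int_closed[OF \<open>compact T\<close>])
  moreover have "T \<inter> V = V" by (auto simp: V_def)
  ultimately have "compact V" by simp
  have "(x\<^sub>0, y\<^sub>0) \<in> V" using neg x0 by (auto simp: V_def T_def)
  then obtain p where p: "p \<in> V" "\<And>q. q \<in> V \<Longrightarrow> fst p \<le> fst q"
    using continuous_attains_inf[OF \<open>compact V\<close>, of fst] continuous_on_fst[OF continuous_on_id] by blast
  obtain x y where xy: "p = (x, y)" by (cases p)
  have pT: "(x, y) \<in> T" using p(1) xy by (auto simp: V_def)
  then have x: "a \<le> x" "x \<le> x\<^sub>0" "x < b" "\<bar>y - y\<^sub>0\<bar> \<le> K * (x\<^sub>0 - x)" using x0 by (auto simp: T_def)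
  have "x \<noteq> a" using p(1) init by (auto simp: xy V_def not_le[symmetric])
  then have ax: "a < x" using x by simp
  \<comment> \<open>A backward step with slope at most \<open>K\<close> stays in \<open>T\<close>
    and lowers the first coordinate, so by minimality it lands outside \<open>V\<close>.\<close>
  have earlier: "\<forall>\<^sub>F t in at_right 0. \<bar>u (x - t, y - t * k)\<bar> < B (x - t) \<and> \<bar>w (x - t, y - t * k)\<bar> < \<Omega> (x - t)"
    if "\<bar>k\<bar> \<le> K" for k
  proof -
    have "\<forall>\<^sub>F t in at_right 0. 0 < t \<and> t < x - a"
      using ax by (simp add: eventually_at_right_field) (use ax in \<open>metis diff_gt_0_iff_gt\<close>)
    then show ?thesis
    proof eventually_elim
      case (elim t)
      have "\<bar>y - t * k - y\<^sub>0\<bar> \<le> \<bar>y - y\<^sub>0\<bar> + \<bar>t * k\<bar>" by linarith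
      also have "\<bar>t * k\<bar> \<le> t * K" using that elim by (simp add: abs_mult)
      finally have "\<bar>y - t * k - y\<^sub>0\<bar> \<le> K * (x\<^sub>0 - (x - t))"
        using x(4) by (simp add: algebra_simps)
      then have "(x - t, y - t * k) \<in> T" using elim x by (auto simp: T_def)
      moreover have "(x - t, y - t * k) \<notin> V" using p(2) elim xy by fastforce
      ultimately show ?case by (auto simp: V_def)
    qed
  qed
  have xin: "x \<in> {a..x\<^sub>0}" using x by auto
  have eu: "\<forall>\<^sub>F t in at_right 0. \<bar>u (x - t, y - t * c x)\<bar> < B (x - t)"
    using earlier[OF K(1)[OF xin]] by eventually_elim simp
  have ew: "\<forall>\<^sub>F t in at_right 0. \<bar>w (x - t, y - t * d x)\<bar> < \<Omega> (x - t)"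
    using earlier[OF K(2)[OF xin]] by eventually_elim simp
  \<comment> \<open>Each quantity is either below its barrier or in contact with it, and contact
    forces equality.\<close>
  have le: "\<bar>u (x, y)\<bar> \<le> B x" "\<bar>w (x, y)\<bar> \<le> \<Omega> x"
    using first_contact_derivative(1)[OF U[OF ax x(3)] B[OF ax x(3)] pos(1)[OF ax x(3)] _ eu]
      first_contact_derivative(1)[OF W[OF ax x(3)] \<Omega>[OF ax x(3)] pos(2)[OF ax x(3)] _ ew]
    by (metis linorder_le_cases order_refl)+
  consider "B x \<le> \<bar>u (x, y)\<bar>" | "\<Omega> x \<le> \<bar>w (x, y)\<bar>" using p(1) xy by (auto simp: V_def)
  then show False
  proof cases
    case 1
    show False
      using first_contact_derivative(2)[OF U[OF ax x(3)] B[OF ax x(3)] pos(1)[OF ax x(3)] 1 eu]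
        super_u[OF ax x(3) _ le(2)] 1 le(1) by fastforce
  next
    case 2
    show False
      using first_contact_derivative(2)[OF W[OF ax x(3)] \<Omega>[OF ax x(3)] pos(2)[OF ax x(3)] 2 ew]
        super_w[OF ax x(3) _ le(1)] 2 le(2) by fastforce
  qed
qed

text \<open>Ingoing lines have the form \<open>y = s - ln x\<close>, and along them increments of
  \<open>u\<close> are bounded by those of the convergent \<open>k\<close>. For fixed
  \<open>y\<close>, the point \<open>(x, y)\<close> is followed back along its line to a fixed
  abscissa \<open>x1\<close> near \<open>b\<close>; continuity of \<open>u\<close> there gives the
  Cauchy property.\<close>

lemma convergent_along_ingoing_lines:
  fixes u :: "real \<times> real \<Rightarrow> real" and k k' :: "real \<Rightarrow> real"
  assumes "0 < a" "a < b"
    and cont: "continuous_on ({a..<b} \<times> UNIV) u"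
    and U: "\<And>x y. a < x \<Longrightarrow> x < b \<Longrightarrow> (u has_derivative U (x, y)) (at (x, y))"
    and k: "\<And>x. a < x \<Longrightarrow> x < b \<Longrightarrow> (k has_real_derivative k' x) (at x)"
    and klim: "(k \<longlongrightarrow> L) (at_left b)"
    and bound: "\<And>x y. a < x \<Longrightarrow> x < b \<Longrightarrow> \<bar>U (x, y) (1, - 1 / x)\<bar> \<le> k' x"
  shows "\<exists>l. ((\<lambda>x. u (x, y)) \<longlongrightarrow> l) (at_left b)"
proof -
  have lines: "\<bar>u (x2, s - ln x2) - u (x1, s - ln x1)\<bar> \<le> k x2 - k x1"
    if "a < x1" "x1 \<le> x2" "x2 < b" for x1 x2 s
  proof -
    have der: "((\<lambda>x. u (x, s - ln x)) has_real_derivative U (x, s - ln x) (1, - 1 / x)) (at x)"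
      if "a < x" "x < b" for x
    proof -
      note Ux = U[OF that, of "s - ln x"]
      have lin: "linear (U (x, s - ln x))" using Ux has_derivative_linear by blast
      have "((\<lambda>x. u (x, s - ln x)) has_derivative (\<lambda>h. U (x, s - ln x) (h, - (h / x)))) (at x)"
        by (rule has_derivative_compose[where f="\<lambda>x. (x, s - ln x)" and g=u])
           (use Ux that \<open>0 < a\<close> in \<open>auto intro!: derivative_eq_intros simp: divide_inverse\<close>)
      moreover have "(\<lambda>h. U (x, s - ln x) (h, - (h / x))) = (\<lambda>h. U (x, s - ln x) (1, - 1 / x) * h)"
      proof
        fix h show "U (x, s - ln x) (h, - (h / x)) = U (x, s - ln x) (1, - 1 / x) * h"
          using linear_scale[OF lin, of h "(1, - 1 / x)"] by simp
      qed
      ultimately show ?thesis unfolding has_field_derivative_def by metis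
    qed
    \<comment> \<open>Monotonicity of both \<open>k - u\<close> and \<open>k + u\<close> along the
      line bounds the increment of \<open>u\<close> in absolute value.\<close>
    have "k x1 - u (x1, s - ln x1) \<le> k x2 - u (x2, s - ln x2)"
    proof (rule DERIV_nonneg_imp_nondecreasing[OF \<open>x1 \<le> x2\<close>])
      fix x assume "x1 \<le> x" "x \<le> x2"
      with that have "a < x" "x < b" by auto
      then show "\<exists>D. ((\<lambda>x. k x - u (x, s - ln x)) has_real_derivative D) (at x) \<and> 0 \<le> D"
        using bound[of x "s - ln x"]
        by (intro exI[of _ "k' x - U (x, s - ln x) (1, - 1 / x)"] conjI DERIV_diff k der) auto
    qed
    moreover have "k x1 + u (x1, s - ln x1) \<le> k x2 + u (x2, s - ln x2)"
    proof (rule DERIV_nonneg_imp_nondecreasing[OF \<open>x1 \<le> x2\<close>])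
      fix x assume "x1 \<le> x" "x \<le> x2"
      with that have "a < x" "x < b" by auto
      then show "\<exists>D. ((\<lambda>x. k x + u (x, s - ln x)) has_real_derivative D) (at x) \<and> 0 \<le> D"
        using bound[of x "s - ln x"]
        by (intro exI[of _ "k' x + U (x, s - ln x) (1, - 1 / x)"] conjI DERIV_add k der) auto
    qed
    ultimately show ?thesis by linarith
  qed
  have "cauchy_filter (filtermap (\<lambda>x. u (x, y)) (at_left b))"
    unfolding cauchy_filter_metric_filtermap
  proof (intro allI impI)
    fix e :: real assume "e > 0"
    have "\<forall>\<^sub>F x in at_left b. dist (k x) L < e / 8"
      using tendstoD[OF klim, of "e / 8"] \<open>e > 0\<close> by simp
    then obtain x1 where x1: "a < x1" "x1 < b" "\<And>x. x1 \<le> x \<Longrightarrow> x < b \<Longrightarrow> dist (k x) L < e / 8"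
    proof -
      from \<open>\<forall>\<^sub>F x in at_left b. dist (k x) L < e / 8\<close> obtain x' where x': "x' < b" "\<And>x. x' < x \<Longrightarrow> x < b \<Longrightarrow> dist (k x) L < e / 8"
        by (auto simp: eventually_at_left_field)
      define x1 where "x1 = (max a x' + b) / 2"
      have "a < x1" "x' < x1" "x1 < b" using x'(1) \<open>a < b\<close> by (auto simp: x1_def max_def)
      then show thesis using that[of x1] x'(2) by auto
    qed
    \<comment> \<open>The value of \<open>u\<close> at abscissa \<open>x1\<close> on the ingoing
      line through \<open>(x, y)\<close>, for which \<open>s = y + ln x\<close>. It has a limit as
      \<open>x\<close> tends to \<open>b\<close>.\<close>
    let ?v = "\<lambda>x. u (x1, y + ln x - ln x1)"
    have "continuous_on UNIV (\<lambda>z. u (x1, z))"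
      by (rule continuous_on_compose2[OF cont]) (use x1 in \<open>auto intro!: continuous_intros\<close>)
    then have "isCont (\<lambda>x. u (x1, x)) (y + ln b - ln x1)"
      by (simp add: continuous_on_eq_continuous_at)
    then have "isCont ?v b"
      using \<open>0 < a\<close> \<open>a < b\<close>
      by (intro isCont_o2[where g="\<lambda>x. u (x1, x)" and f="\<lambda>x. y + ln x - ln x1"]) (auto intro!: continuous_intros)
    then have "(?v \<longlongrightarrow> ?v b) (at_left b)"
      by (simp add: isCont_def filterlim_at_split)
    then have "\<forall>\<^sub>F x in at_left b. dist (?v x) (?v b) < e / 4"
      by (rule tendstoD) (use \<open>e > 0\<close> in simp)
    moreover have "\<forall>\<^sub>F x in at_left b. x1 < x \<and> x < b"
      using x1(2) by (auto simp: eventually_at_left_field)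
    ultimately have "\<forall>\<^sub>F x in at_left b. dist (u (x, y)) (?v b) < e / 2"
    proof eventually_elim
      case (elim x)
      have "\<bar>u (x, y) - ?v x\<bar> \<le> k x - k x1"
        using lines[of x1 x "y + ln x"] elim x1 by auto
      also have "\<dots> < e / 4"
      proof -
        have "\<bar>k x - L\<bar> < e / 8" "\<bar>k x1 - L\<bar> < e / 8"
          using x1(3)[of x] x1(3)[of x1] elim x1(2) by (simp_all add: dist_real_def)
        then show ?thesis by linarith
      qed
      finally show ?case using elim unfolding dist_real_def by linarith
    qed
    then show "\<exists>P. eventually P (at_left b) \<and> (\<forall>x x'. P x \<and> P x' \<longrightarrow> dist (u (x, y)) (u (x', y)) < e)"
      by (intro exI[of _ "\<lambda>x. dist (u (x, y)) (?v b) < e / 2"])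
         (auto intro: dist_triangle_half_l)
  qed
  then have "\<exists>l. filtermap (\<lambda>x. u (x, y)) (at_left b) \<le> nhds l"
    by (rule cauchy_filter_complete_converges[where A=UNIV]) (auto simp: complete_UNIV filtermap_bot_iff)
  then show ?thesis by (simp add: filterlim_def)
qed

text \<open>The quotient \<open>d x / (b - x)\<close>, continued by \<open>m\<close> at
  \<open>b\<close>, is continuous and positive on a compact interval. Its minimum and maximum are
  the two constants.\<close>

lemma simple_zero_bounds:
  fixes d :: "real \<Rightarrow> real"
  assumes "a < b" and cont: "continuous_on {a..b} d"
    and der: "(d has_real_derivative - m) (at b)" "m > 0" and "d b = 0"
    and pos: "\<And>x. a \<le> x \<Longrightarrow> x < b \<Longrightarrow> d x > 0"
  obtains c C where "c > 0" "C > 0" "\<And>x. a \<le> x \<Longrightarrow> x \<le> b \<Longrightarrow> c * (b - x) \<le> d x \<and> d x \<le> C * (b - x)"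
proof -
  define e where "e = (\<lambda>x. if x = b then m else d x / (b - x))"
  have "isCont (\<lambda>x. if x = b then - m else (d x - d b) / (x - b)) b"
    using der(1) by (simp add: isCont_def has_field_derivative_iff cong: LIM_cong)
  moreover have "(\<lambda>x. - (if x = b then - m else (d x - d b) / (x - b))) = e"
  proof
    fix x
    have "- (d x / (x - b)) = d x / (b - x)" by (metis minus_diff_eq minus_divide_right)
    then show "- (if x = b then - m else (d x - d b) / (x - b)) = e x"
      using \<open>d b = 0\<close> by (simp add: e_def)
  qed
  ultimately have eb: "isCont e b"
    using isCont_minus[of b "\<lambda>x. if x = b then - m else (d x - d b) / (x - b)"] by simp
  have "continuous_on {a..b} e"
    unfolding continuous_on_eq_continuous_within
  proof
    fix x assume x: "x \<in> {a..b}"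
    show "continuous (at x within {a..b}) e"
    proof (cases "x = b")
      case True
      then show ?thesis using eb by (simp add: continuous_at_imp_continuous_at_within)
    next
      case False
      have "continuous (at x within {a..b}) d"
        using cont x by (simp add: continuous_on_eq_continuous_within)
      then have "continuous (at x within {a..b}) (\<lambda>x. d x / (b - x))"
        using False by (intro continuous_intros) auto
      moreover have "\<forall>\<^sub>F y in at x within {a..b}. y \<noteq> b"
        using False by (intro eventually_neq_at_within)
      then have "\<forall>\<^sub>F y in at x within {a..b}. d y / (b - y) = e y"
        by eventually_elim (simp add: e_def)
      ultimately show ?thesis
        using False unfolding continuous_within by (auto simp: e_def elim: Lim_transform_eventually)
    qed
  qed
  moreover have "compact {a..b}" "{a..b} \<noteq> {}" using \<open>a < b\<close> by auto
  ultimately obtain p q where pq: "p \<in> {a..b}" "\<And>x. x \<in> {a..b} \<Longrightarrow> e p \<le> e x"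
      "q \<in> {a..b}" "\<And>x. x \<in> {a..b} \<Longrightarrow> e x \<le> e q"
    using continuous_attains_inf[of "{a..b}" e] continuous_attains_sup[of "{a..b}" e] by metis
  have epos: "e x > 0" if "x \<in> {a..b}" for x
    using that pos[of x] der(2) by (auto simp: e_def)
  have "e p * (b - x) \<le> d x \<and> d x \<le> e q * (b - x)" if "a \<le> x" "x \<le> b" for x
  proof (cases "x = b")
    case True
    then show ?thesis using \<open>d b = 0\<close> by simp
  next
    case False
    then show ?thesis using pq(2,4)[of x] that by (auto simp: e_def field_simps)
  qed
  then show thesis using that[of "e p" "e q"] epos pq by blast
qed

lemma test_function_bounds:
  assumes "test_function f"
  obtains C where "C > 0" "\<And>x. \<bar>f x\<bar> \<le> C" "\<And>x. \<bar>deriv f x\<bar> \<le> C" "\<And>x. (f has_real_derivative deriv f x) (at x)"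
proof -
  define K where "K = closure {x. f x \<noteq> 0}"
  have K: "compact K" and sm: "smooth_on f UNIV"
    using assms by (auto simp: test_function_def K_def)
  have D: "(f has_derivative frechet_derivative f (at x)) (at x)" for x
    using smooth_on_has_derivative[OF sm] by simp
  then have der: "(f has_real_derivative deriv f x) (at x)" for x
    by (metis DERIV_deriv_iff_real_differentiable differentiableI)
  then have "deriv f x = frechet_derivative f (at x) 1" for x
    by (metis D has_derivative_unique has_field_derivative_imp_has_derivative mult.right_neutral)
  then have cont': "continuous_on UNIV (deriv f)"
    using smooth_on_imp_continuous_on[OF smooth_on_frechet_derivative[OF sm, of 1]] by simp
  have f0: "f x = 0" if "x \<notin> K" for x
    using that closure_subset[of "{x. f x \<noteq> 0}"] by (auto simp: K_def)
  have d0: "deriv f x = 0" if "x \<notin> K" for x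
  proof -
    have "open (- K)" using K compact_imp_closed by auto
    then have "((\<lambda>_. 0) has_real_derivative deriv f x) (at x)"
      using der has_field_derivative_transform_within_open[of f "deriv f x" x "- K" "\<lambda>_. 0"] that f0 by auto
    then show ?thesis using DERIV_unique DERIV_const by metis
  qed
  obtain C1 where C1: "\<And>x. x \<in> K \<Longrightarrow> \<bar>f x\<bar> \<le> C1"
    using compact_imp_bounded[OF compact_continuous_image[OF
        continuous_on_subset[OF smooth_on_imp_continuous_on[OF sm]] K]]
    unfolding bounded_iff by auto
  obtain C2 where C2: "\<And>x. x \<in> K \<Longrightarrow> \<bar>deriv f x\<bar> \<le> C2"
    using compact_imp_bounded[OF compact_continuous_image[OF continuous_on_subset[OF cont'] K]]
    unfolding bounded_iff by auto
  show thesis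
  \<comment> \<open>The 1 keeps the bound positive and covers the points outside the
    support.\<close>
  proof (rule that[of "max 1 (max C1 C2)"])
    show "\<bar>f x\<bar> \<le> max 1 (max C1 C2)" for x using C1[of x] f0[of x] by (cases "x \<in> K") auto
    show "\<bar>deriv f x\<bar> \<le> max 1 (max C1 C2)" for x using C2[of x] d0[of x] by (cases "x \<in> K") auto
  qed (use der in auto)
qed

subsection \<open>Boundedness up to the Cauchy horizon\<close>

theorem theorem4:
  fixes G \<psi> f g :: "real \<Rightarrow> real" and x\<^sub>c x\<^sub>i \<kappa> :: real and l :: nat
    and \<phi> :: "real \<times> real \<Rightarrow> real"
  assumes "x\<^sub>c > 0" and "x\<^sub>c * G x\<^sub>c - 1 = 0"
    and "\<And>x. 0 < x \<Longrightarrow> x < x\<^sub>c \<Longrightarrow> x * G x - 1 \<noteq> 0"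
    and "real_analytic_on G {..x\<^sub>c}" and "real_analytic_on \<psi> {..x\<^sub>c}"
    and "\<And>x. x \<le> x\<^sub>c \<Longrightarrow> x * deriv \<psi> x \<le> 0"
    and "\<And>x. x \<le> x\<^sub>c \<Longrightarrow> deriv G x - deriv \<psi> x * (1 - x * G x) * G x \<le> 0"
    and "\<And>x. x \<le> x\<^sub>c \<Longrightarrow> G x > 0"
    and "\<And>x. 0 < x \<Longrightarrow> x < x\<^sub>c \<Longrightarrow> deriv G x < 0"
    and "deriv G x\<^sub>c < 0"
    and "1 + x\<^sub>c\<^sup>2 * deriv G x\<^sub>c > 0"
    and "0 < x\<^sub>i" and "x\<^sub>i < x\<^sub>c"
    and "0 \<le> \<kappa>" and "\<kappa> < min 1 ((1 - x\<^sub>c\<^sup>2 * deriv G x\<^sub>c) / 2)"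
    and "test_function f" and "test_function g"
    and "smooth_on \<phi> ({x\<^sub>i..<x\<^sub>c} \<times> UNIV)"
    and "wave_equation_on ({x\<^sub>i..<x\<^sub>c} \<times> UNIV) G \<psi> l \<kappa> \<phi>"
    and "\<And>\<rho>. \<phi> (x\<^sub>i, \<rho>) = f \<rho>"
    and "\<And>\<rho>. d_x ({x\<^sub>i..<x\<^sub>c} \<times> UNIV) \<phi> (x\<^sub>i, \<rho>) = g \<rho>"
  shows "\<exists>\<Phi>. (\<forall>x\<in>{x\<^sub>i..<x\<^sub>c}. \<forall>\<rho>. \<Phi> (x, \<rho>) = \<phi> (x, \<rho>)) \<and>
             (\<forall>\<rho>. ((\<lambda>x. \<phi> (x, \<rho>)) \<longlongrightarrow> \<Phi> (x\<^sub>c, \<rho>)) (at_left x\<^sub>c)) \<and>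
             bounded (\<Phi> ` ({x\<^sub>i..x\<^sub>c} \<times> UNIV))"
proof -
  note xi = \<open>0 < x\<^sub>i\<close> \<open>x\<^sub>i < x\<^sub>c\<close>
  let ?S = "{x\<^sub>i..<x\<^sub>c} \<times> (UNIV :: real set)"
  define a where "a = 1 - \<kappa>"
  have a: "a > 0" using assms(15) by (simp add: a_def)
  define d where "d = (\<lambda>x. 1 - x * G x)"

  \<comment> \<open>Regularity of the background and the damping rate near the horizon\<close>
  have G_der: "(G has_real_derivative deriv G x) (at x)" if "x \<le> x\<^sub>c" for x
    using real_analytic_on_C1(1)[OF assms(4)] that by simp
  have G_cont: "continuous_on {..x\<^sub>c} G"
    by (intro continuous_at_imp_continuous_on ballI DERIV_isCont[OF G_der]) simp
  have G'_cont: "continuous_on {..x\<^sub>c} (deriv G)"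
    by (intro continuous_at_imp_continuous_on ballI real_analytic_on_C1(2)[OF assms(4)])
  have \<psi>_cont: "continuous_on {..x\<^sub>c} \<psi>"
    by (intro continuous_at_imp_continuous_on ballI DERIV_isCont[OF real_analytic_on_C1(1)[OF assms(5)]])
  have d_cont: "continuous_on {..x\<^sub>c} d"
    unfolding d_def by (intro continuous_intros G_cont)
  \<comment> \<open>Since \<open>d 0 = 1\<close>, a nonpositive value would produce a zero strictly
    between 0 and the horizon by the intermediate value theorem.\<close>
  have d_pos: "d x > 0" if "x\<^sub>i \<le> x" "x < x\<^sub>c" for x
  proof (rule ccontr)
    assume "\<not> d x > 0"
    then have "\<exists>z\<ge>0. z \<le> x \<and> d z = 0"
      using that xi continuous_on_subset[OF d_cont, of "{0..x}"] by (intro IVT2') (auto simp: d_def)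
    then obtain z where "0 \<le> z" "z \<le> x" "d z = 0" by blast
    moreover from this have "z \<noteq> 0" by (auto simp: d_def)
    ultimately show False using assms(3)[of z] that by (auto simp: d_def)
  qed
  have d_zero: "d x\<^sub>c = 0" using assms(2) by (simp add: d_def)
  have d_der: "(d has_real_derivative - (G x\<^sub>c + x\<^sub>c * deriv G x\<^sub>c)) (at x\<^sub>c)"
    unfolding d_def by (auto intro!: derivative_eq_intros G_der)
  \<comment> \<open>As \<open>x\<^sub>c * G x\<^sub>c = 1\<close>, the left side equals
    \<open>1 + x\<^sub>c\<^sup>2 * deriv G x\<^sub>c\<close>. The zero of \<open>d\<close> at the
    horizon is therefore simple.\<close>
  have "x\<^sub>c * (G x\<^sub>c + x\<^sub>c * deriv G x\<^sub>c) > 0"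
    using assms(2,11) by (simp add: algebra_simps power2_eq_square)
  then have slope: "G x\<^sub>c + x\<^sub>c * deriv G x\<^sub>c > 0"
    using \<open>x\<^sub>c > 0\<close> by (simp add: zero_less_mult_iff)
  have "{x\<^sub>i..x\<^sub>c} \<subseteq> {..x\<^sub>c}" by auto
  then obtain c C where c: "c > 0" "C > 0"
    and d_bounds: "\<And>x. x\<^sub>i \<le> x \<Longrightarrow> x \<le> x\<^sub>c \<Longrightarrow> c * (x\<^sub>c - x) \<le> d x \<and> d x \<le> C * (x\<^sub>c - x)"
    using simple_zero_bounds[OF xi(2) continuous_on_subset[OF d_cont] d_der slope d_zero d_pos] by metis
  obtain z where z: "z \<in> {x\<^sub>i..x\<^sub>c}" "\<And>x. x \<in> {x\<^sub>i..x\<^sub>c} \<Longrightarrow> G z \<le> G x"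
    using continuous_attains_inf[of "{x\<^sub>i..x\<^sub>c}" G] continuous_on_subset[OF G_cont, of "{x\<^sub>i..x\<^sub>c}"] xi by auto
  \<comment> \<open>The second entry combines the least value of \<open>G\<close> with the upper
    bound for \<open>d\<close>. The cap 1 later keeps the exponent \<open>\<delta>\<close> below
    1.\<close>
  define A where "A = min 1 (a * G z / C)"
  have A: "0 < A" "A \<le> 1" using a c assms(8)[of z] z(1) by (auto simp: A_def)
  have damping: "A / (x\<^sub>c - x) \<le> a * G x / d x" if "x\<^sub>i \<le> x" "x < x\<^sub>c" for x
  proof -
    have "A * C \<le> a * G z" using c by (simp add: A_def min_def field_simps)
    also have "\<dots> \<le> a * G x" using z(2)[of x] that a by simp
    finally have AC: "A * C \<le> a * G x" .
    have "A * d x \<le> A * (C * (x\<^sub>c - x))" using d_bounds[of x] that A by (intro mult_left_mono) auto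
    also have "\<dots> \<le> (a * G x) * (x\<^sub>c - x)" using mult_right_mono[OF AC, of "x\<^sub>c - x"] that by (simp add: mult.assoc)
    finally show ?thesis using d_pos[OF that] that by (simp add: field_simps)
  qed

  define q where "q = (\<lambda>x. x * deriv G x - real l * (real l + 1) * exp (\<psi> x) / 2)"
  have "continuous_on {x\<^sub>i..x\<^sub>c} q"
    unfolding q_def by (intro continuous_intros continuous_on_subset[OF G'_cont] continuous_on_subset[OF \<psi>_cont]) auto
  then have "bounded (q ` {x\<^sub>i..x\<^sub>c})"
    by (intro compact_imp_bounded compact_continuous_image) auto
  then obtain Q where Q: "Q > 0" "\<And>x. x \<in> {x\<^sub>i..x\<^sub>c} \<Longrightarrow> \<bar>q x\<bar> \<le> Q"
    unfolding bounded_pos by auto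

  \<comment> \<open>The first-order system for \<open>\<phi>\<close> and \<open>w\<close>\<close>
  obtain P R where PR: "smooth_on P ?S" "smooth_on R ?S"
    "\<And>p. p \<in> ?S \<Longrightarrow> (\<phi> has_derivative (\<lambda>h. fst h * P p + snd h * R p)) (at p within ?S)"
    using smooth_on_partials[OF assms(18)] by blast
  define w where "w = (\<lambda>p. (1 - fst p * G (fst p)) * (fst p * P p - R p - (1 - \<kappa>) * \<phi> p))"
  define U where "U = (\<lambda>p h. fst h * P p + snd h * R p :: real)"
  have \<phi>_der: "(\<phi> has_derivative U (x, \<rho>)) (at (x, \<rho>))" if "x\<^sub>i < x" "x < x\<^sub>c" for x \<rho>
    using PR(3)[of "(x, \<rho>)"] open_strip_at[OF that] that by (simp add: U_def)
  \<comment> \<open>This is the definition of \<open>w\<close> solved for the ingoing derivative;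
    the wave equation enters only through \<open>outgoing\<close>.\<close>
  have ingoing: "U (x, \<rho>) (1, - 1 / x) = a / x * \<phi> (x, \<rho>) + w (x, \<rho>) / (x * d x)"
    if "x\<^sub>i < x" "x < x\<^sub>c" for x \<rho>
    using d_pos[of x] that xi unfolding U_def w_def a_def d_def by (simp add: field_simps)
  have "\<forall>p\<in>{x\<^sub>i<..<x\<^sub>c} \<times> UNIV. \<exists>W. (w has_derivative W) (at p) \<and>
          W (1, G (fst p) / d (fst p)) = - (a * G (fst p) / d (fst p)) * w p + q (fst p) * \<phi> p"
  proof
    fix p assume "p \<in> {x\<^sub>i<..<x\<^sub>c} \<times> (UNIV :: real set)"
    then obtain x \<rho> where p: "p = (x, \<rho>)" and x: "x\<^sub>i < x" "x < x\<^sub>c" by auto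
    have "1 - x * G x \<noteq> 0" using d_pos[of x] x by (simp add: d_def)
    from wave_equation_outgoing_transport[OF xi(2) assms(18) PR assms(19) x G_der this, of \<rho>] x
    show "\<exists>W. (w has_derivative W) (at p) \<and>
          W (1, G (fst p) / d (fst p)) = - (a * G (fst p) / d (fst p)) * w p + q (fst p) * \<phi> p"
      unfolding p fst_conv w_def a_def d_def q_def by simp
  qed
  from bchoice[OF this] obtain W where W': "\<forall>p\<in>{x\<^sub>i<..<x\<^sub>c} \<times> UNIV. (w has_derivative W p) (at p) \<and>
          W p (1, G (fst p) / d (fst p)) = - (a * G (fst p) / d (fst p)) * w p + q (fst p) * \<phi> p"
    by blast
  have W: "(w has_derivative W (x, \<rho>)) (at (x, \<rho>))"
    and outgoing: "W (x, \<rho>) (1, G x / d x) = - (a * G x / d x) * w (x, \<rho>) + q x * \<phi> (x, \<rho>)"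
    if "x\<^sub>i < x" "x < x\<^sub>c" for x \<rho>
    using bspec[OF W', of "(x, \<rho>)"] that by simp_all

  \<comment> \<open>Bounds on the initial data\<close>
  obtain Cf where Cf: "Cf > 0" "\<And>\<rho>. \<bar>f \<rho>\<bar> \<le> Cf" "\<And>\<rho>. \<bar>deriv f \<rho>\<bar> \<le> Cf" "\<And>\<rho>. (f has_real_derivative deriv f \<rho>) (at \<rho>)"
    using test_function_bounds[OF assms(16)] by metis
  obtain Cg where Cg: "Cg > 0" "\<And>\<rho>. \<bar>g \<rho>\<bar> \<le> Cg"
    using test_function_bounds[OF assms(17)] by metis
  have init_P: "P (x\<^sub>i, \<rho>) = g \<rho>" for \<rho>
    using d_x_strip[OF xi(2) _ PR(3), of "(x\<^sub>i, \<rho>)" \<phi>] assms(21) xi by simp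
  have init_R: "R (x\<^sub>i, \<rho>) = deriv f \<rho>" for \<rho>
  proof -
    have "R (x\<^sub>i, \<rho>) = d_rho ?S \<phi> (x\<^sub>i, \<rho>)"
      using d_rho_strip[OF xi(2) _ PR(3), of "(x\<^sub>i, \<rho>)" \<phi>] xi by simp
    also have "\<dots> = vector_derivative f (at \<rho>)"
      using xi by (simp add: d_rho_def assms(20))
    also have "\<dots> = deriv f \<rho>"
      using Cf(4) by (intro vector_derivative_at) (simp add: has_real_derivative_iff_has_vector_derivative)
    finally show ?thesis .
  qed
  define \<omega> where "\<omega> = d x\<^sub>i * (x\<^sub>i * Cg + Cf + a * Cf)"
  have init_w: "\<bar>w (x\<^sub>i, \<rho>)\<bar> \<le> \<omega>" for \<rho>
  proof -
    have "\<bar>x\<^sub>i * g \<rho> - deriv f \<rho> - a * f \<rho>\<bar> \<le> \<bar>x\<^sub>i * g \<rho>\<bar> + \<bar>deriv f \<rho>\<bar> + \<bar>a * f \<rho>\<bar>" by linarith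
    also have "\<dots> \<le> x\<^sub>i * Cg + Cf + a * Cf"
      using Cf Cg a xi by (intro add_mono) (auto simp: abs_mult)
    finally have "d x\<^sub>i * \<bar>x\<^sub>i * g \<rho> - deriv f \<rho> - a * f \<rho>\<bar> \<le> \<omega>"
      unfolding \<omega>_def using d_pos[of x\<^sub>i] xi by (intro mult_left_mono) auto
    then show ?thesis
      using d_pos[of x\<^sub>i] xi by (simp add: w_def d_def init_P init_R assms(20) abs_mult a_def)
  qed
  have "\<omega> \<ge> 0" using init_w[of 0] by linarith

  \<comment> \<open>Construction of the supersolution\<close>
  define \<delta> where "\<delta> = A / 2"
  have \<delta>: "0 < \<delta>" "\<delta> < 1" using A by (auto simp: \<delta>_def)
  define r where "r = (\<lambda>x. (x\<^sub>c - x) powr (\<delta> - 1))"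
  \<comment> \<open>Chosen so that \<open>N * \<delta> * r x\<close> exceeds \<open>Q\<close> at the
    initial abscissa; as the exponent \<open>\<delta> - 1\<close> is negative, \<open>r\<close>
    increases and the inequality persists.\<close>
  define N where "N = Q / (\<delta> * r x\<^sub>i) + 1"
  have r_pos: "r x > 0" if "x < x\<^sub>c" for x using that by (simp add: r_def)
  have r_mono: "r x\<^sub>i \<le> r x" if "x\<^sub>i \<le> x" "x < x\<^sub>c" for x
    unfolding r_def using that \<delta> by (intro powr_mono2') auto
  have powr_r: "(x\<^sub>c - x) powr \<delta> = (x\<^sub>c - x) * r x" if "x < x\<^sub>c" for x
    using that powr_add[of "x\<^sub>c - x" 1 "\<delta> - 1"] by (simp add: r_def)
  have N: "N > 0" using Q(1) \<delta>(1) r_pos[OF xi(2)] by (simp add: N_def add_pos_pos)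
  have NQ: "Q < N * \<delta> * r x" if "x\<^sub>i \<le> x" "x < x\<^sub>c" for x
  proof -
    have pos: "\<delta> * r x\<^sub>i > 0" using \<delta>(1) r_pos[OF xi(2)] by simp
    have "N * (\<delta> * r x\<^sub>i) = Q + \<delta> * r x\<^sub>i"
      using \<delta>(1) r_pos[OF xi(2)] unfolding N_def distrib_right by simp
    with pos have "Q < N * (\<delta> * r x\<^sub>i)" by simp
    also have "\<dots> \<le> N * (\<delta> * r x)" using N \<delta>(1) r_mono[OF that] by simp
    finally show ?thesis by (simp add: mult.assoc)
  qed
  \<comment> \<open>The exponent has derivative
    \<open>(a + 1) / x\<^sub>i + N * r x / (x\<^sub>i * c)\<close>. The first term exceeds
    \<open>a / x\<close>, with the 1 giving strictness; the second dominates the contribution of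
    \<open>w\<close>, and is integrable because \<open>\<delta> > 0\<close>.\<close>
  define E where "E = (\<lambda>x. exp ((a + 1) / x\<^sub>i * x - N / (x\<^sub>i * c * \<delta>) * (x\<^sub>c - x) powr \<delta>))"
  \<comment> \<open>Dividing by the initial value of \<open>E\<close> fixes the initial value of
    \<open>B\<close>. Its summands cover the data of \<open>\<phi>\<close> and of \<open>w\<close>,
    and the 1 makes both bounds strict.\<close>
  define M where "M = (Cf + \<omega> / (N * (x\<^sub>c - x\<^sub>i) powr \<delta>) + 1) / E x\<^sub>i"
  define B where "B = (\<lambda>x. M * E x)"
  define B' where "B' = (\<lambda>x. B x * ((a + 1) / x\<^sub>i + N * r x / (x\<^sub>i * c)))"
  define \<Omega> where "\<Omega> = (\<lambda>x. N * (x\<^sub>c - x) powr \<delta> * B x)"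
  define \<Omega>' where "\<Omega>' = (\<lambda>x. N * (- \<delta> * r x) * B x + N * (x\<^sub>c - x) powr \<delta> * B' x)"
  have y\<delta>: "(x\<^sub>c - x\<^sub>i) powr \<delta> > 0" using xi by simp
  have Mpos: "M > 0"
    unfolding M_def using Cf(1) \<open>\<omega> \<ge> 0\<close> N y\<delta> by (intro divide_pos_pos add_nonneg_pos) (auto simp: E_def)
  have Bpos: "B x > 0" for x using Mpos by (simp add: B_def E_def)
  have pow_der: "((\<lambda>x. (x\<^sub>c - x) powr \<delta>) has_real_derivative - \<delta> * r x) (at x)" if "x < x\<^sub>c" for x
    unfolding r_def using that by (auto intro!: derivative_eq_intros simp: powr_diff field_simps)
  have B_der: "(B has_real_derivative B' x) (at x)" if "x < x\<^sub>c" for x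
    unfolding B'_def B_def E_def
    by (rule derivative_eq_intros pow_der[OF that] refl)+ (use \<delta> c xi in \<open>simp add: field_simps\<close>)
  have \<Omega>_der: "(\<Omega> has_real_derivative \<Omega>' x) (at x)" if "x < x\<^sub>c" for x
    unfolding \<Omega>_def \<Omega>'_def
    by (rule derivative_eq_intros pow_der[OF that] B_der[OF that] refl)+ simp
  have B_cont: "continuous_on {x\<^sub>i..x\<^sub>c} B"
    unfolding B_def E_def using \<delta> by (intro continuous_intros continuous_on_powr') auto
  have B'_ge: "a / x * B x + \<Omega> x / (x * d x) < B' x" if "x\<^sub>i \<le> x" "x < x\<^sub>c" for x
  proof -
    have "a / x \<le> a / x\<^sub>i" using that a xi by (intro divide_left_mono) auto
    also have "\<dots> < (a + 1) / x\<^sub>i" using xi by (intro divide_strict_right_mono) auto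
    finally have 1: "a / x * B x < (a + 1) / x\<^sub>i * B x"
      using Bpos[of x] by (intro mult_strict_right_mono)
    have "x\<^sub>i * (c * (x\<^sub>c - x)) \<le> x * d x"
      using d_bounds[of x] that xi c by (intro mult_mono) auto
    then have "\<Omega> x / (x * d x) \<le> \<Omega> x / (x\<^sub>i * (c * (x\<^sub>c - x)))"
      using that xi c N Bpos[of x] d_pos[OF that] by (intro divide_left_mono) (auto simp: \<Omega>_def)
    also have "\<dots> = N * r x / (x\<^sub>i * c) * B x"
      using powr_r[OF that(2)] that by (simp add: \<Omega>_def)
    finally show ?thesis using 1 by (simp add: B'_def algebra_simps)
  qed
  have \<Omega>'_gt: "- (a * G x / d x) * \<Omega> x + Q * B x < \<Omega>' x" if "x\<^sub>i \<le> x" "x < x\<^sub>c" for x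
  proof -
    have "\<Omega> x \<ge> 0" using N Bpos[of x] by (simp add: \<Omega>_def)
    then have "A / (x\<^sub>c - x) * \<Omega> x \<le> a * G x / d x * \<Omega> x"
      using damping[OF that] by (intro mult_right_mono)
    \<comment> \<open>Here \<open>A = 2 * \<delta>\<close> pays off: one half of the damping
      compensates the decay of the power in \<open>\<Omega>\<close>, the other absorbs the source
      \<open>Q * B x\<close>.\<close>
    moreover have "A / (x\<^sub>c - x) * \<Omega> x = 2 * (N * \<delta> * r x) * B x"
      using powr_r[OF that(2)] that(2) by (simp add: \<Omega>_def \<delta>_def)
    moreover have "Q * B x < (N * \<delta> * r x) * B x"
      using NQ[OF that] Bpos[of x] by simp
    moreover have "0 \<le> B' x"
      using Bpos[of x] a xi N c r_pos[OF that(2)] by (simp add: B'_def)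
    then have "0 \<le> N * (x\<^sub>c - x) powr \<delta> * B' x" using N by simp
    ultimately show ?thesis unfolding \<Omega>'_def by (simp add: algebra_simps)
  qed
  have \<phi>_cont: "continuous_on ?S \<phi>" by (rule smooth_on_imp_continuous_on[OF assms(18)])
  have fst_S: "fst ` ?S \<subseteq> {..x\<^sub>c}" by auto
  have w_cont: "continuous_on ?S w"
    unfolding w_def
    by (intro continuous_intros \<phi>_cont smooth_on_imp_continuous_on[OF PR(1)] smooth_on_imp_continuous_on[OF PR(2)]
          continuous_on_compose2[OF G_cont _ fst_S])
  \<comment> \<open>Only \<open>k2\<close> is replaced by its absolute value; \<open>k1\<close>
    keeps its sign, so that the damping of \<open>w\<close> is not lost.\<close>
  have sgn_le: "sgn s * (k1 * s + k2 * t) \<le> k1 * \<bar>s\<bar> + \<bar>k2\<bar> * \<bar>t\<bar>" for s t k1 k2 :: real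
  proof -
    have "k2 * t \<le> \<bar>k2\<bar> * \<bar>t\<bar>" "- (k2 * t) \<le> \<bar>k2\<bar> * \<bar>t\<bar>" by (simp_all flip: abs_mult)
    then show ?thesis by (cases s "0 :: real" rule: linorder_cases) auto
  qed

  \<comment> \<open>Comparison of the solution with the supersolution\<close>
  have main: "\<bar>\<phi> (x, \<rho>)\<bar> < B x \<and> \<bar>w (x, \<rho>)\<bar> < \<Omega> x" if "x\<^sub>i \<le> x" "x < x\<^sub>c" for x \<rho>
  proof (rule two_speed_comparison[where a=x\<^sub>i and b=x\<^sub>c and u=\<phi> and w=w and c="\<lambda>x. - 1 / x" and d="\<lambda>x. G x / d x"
        and B=B and \<Omega>=\<Omega> and B'=B' and \<Omega>'=\<Omega>' and U=U and W=W])
    show "continuous_on {x\<^sub>i..<x\<^sub>c} (\<lambda>x. - 1 / x)" using xi by (intro continuous_intros) auto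
    have "d x \<noteq> 0" if "x \<in> {x\<^sub>i..<x\<^sub>c}" for x using d_pos[of x] that by auto
    then show "continuous_on {x\<^sub>i..<x\<^sub>c} (\<lambda>x. G x / d x)"
      by (intro continuous_intros continuous_on_subset[OF G_cont] continuous_on_subset[OF d_cont]) auto
    show "continuous_on {x\<^sub>i..<x\<^sub>c} B" "continuous_on {x\<^sub>i..<x\<^sub>c} \<Omega>"
      by (auto intro!: continuous_at_imp_continuous_on DERIV_isCont[OF B_der] DERIV_isCont[OF \<Omega>_der])
    show "0 < \<Omega> x" if "x\<^sub>i < x" "x < x\<^sub>c" for x using that N Bpos by (simp add: \<Omega>_def)
    have Bi: "B x\<^sub>i = Cf + \<omega> / (N * (x\<^sub>c - x\<^sub>i) powr \<delta>) + 1" by (simp add: B_def M_def E_def)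
    have "\<omega> / (N * (x\<^sub>c - x\<^sub>i) powr \<delta>) \<ge> 0" using \<open>\<omega> \<ge> 0\<close> N by simp
    then show "\<bar>\<phi> (x\<^sub>i, y)\<bar> < B x\<^sub>i" for y
      unfolding Bi assms(20) using Cf(2)[of y] by linarith
    have "\<omega> < \<Omega> x\<^sub>i"
      unfolding \<Omega>_def Bi using N y\<delta> Cf(1) by (simp add: field_simps add_pos_pos)
    then show "\<bar>w (x\<^sub>i, y)\<bar> < \<Omega> x\<^sub>i" for y using init_w[of y] by linarith
    show "sgn (\<phi> (x, y)) * U (x, y) (1, - 1 / x) < B' x"
      if "x\<^sub>i < x" "x < x\<^sub>c" "\<bar>\<phi> (x, y)\<bar> = B x" "\<bar>w (x, y)\<bar> \<le> \<Omega> x" for x y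
    proof -
      have xd: "x * d x > 0" using that d_pos[of x] xi by simp
      have "sgn (\<phi> (x, y)) * U (x, y) (1, - 1 / x) \<le> a / x * B x + \<bar>1 / (x * d x)\<bar> * \<bar>w (x, y)\<bar>"
        using sgn_le[of "\<phi> (x, y)" "a / x" "1 / (x * d x)" "w (x, y)"] that(3) ingoing[OF that(1,2)] by simp
      also have "\<dots> \<le> a / x * B x + \<Omega> x / (x * d x)"
        using that(4) xd by (simp add: divide_right_mono)
      also have "\<dots> < B' x" using B'_ge[of x] that by simp
      finally show ?thesis .
    qed
    show "sgn (w (x, y)) * W (x, y) (1, G x / d x) < \<Omega>' x"
      if "x\<^sub>i < x" "x < x\<^sub>c" "\<bar>w (x, y)\<bar> = \<Omega> x" "\<bar>\<phi> (x, y)\<bar> \<le> B x" for x y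
    proof -
      have "sgn (w (x, y)) * W (x, y) (1, G x / d x) \<le> - (a * G x / d x) * \<Omega> x + \<bar>q x\<bar> * \<bar>\<phi> (x, y)\<bar>"
        using sgn_le[of "w (x, y)" "- (a * G x / d x)" "q x" "\<phi> (x, y)"] that(3) outgoing[OF that(1,2)] by simp
      also have "\<dots> \<le> - (a * G x / d x) * \<Omega> x + Q * B x"
        using Q that(4) that(1,2) by (intro add_left_mono mult_mono) auto
      also have "\<dots> < \<Omega>' x" using \<Omega>'_gt[of x] that by simp
      finally show ?thesis .
    qed
  qed (use \<phi>_cont w_cont \<phi>_der W B_der \<Omega>_der Bpos that in auto)

  \<comment> \<open>The limit at the Cauchy horizon and the uniform bound\<close>
  have B_lim: "(B \<longlongrightarrow> B x\<^sub>c) (at_left x\<^sub>c)"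
    using B_cont xi by (auto simp: continuous_on_def simp flip: at_within_Icc_at_left)
  \<comment> \<open>The inequality \<open>B'_ge\<close> used for the comparison also bounds the
    ingoing derivative in absolute value, so \<open>B\<close> itself serves as the convergent
    majorant \<open>k\<close>.\<close>
  have U_bound: "\<bar>U (x, \<rho>) (1, - 1 / x)\<bar> \<le> B' x" if "x\<^sub>i < x" "x < x\<^sub>c" for x \<rho>
  proof -
    have xd: "d x > 0" "x > 0" using that d_pos[of x] xi by auto
    have "\<bar>U (x, \<rho>) (1, - 1 / x)\<bar> \<le> \<bar>a / x * \<phi> (x, \<rho>)\<bar> + \<bar>w (x, \<rho>) / (x * d x)\<bar>"
      unfolding ingoing[OF that] by (rule abs_triangle_ineq)
    also have "\<dots> = a / x * \<bar>\<phi> (x, \<rho>)\<bar> + \<bar>w (x, \<rho>)\<bar> / (x * d x)"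
      using xd a by (simp add: abs_mult abs_divide)
    also have "\<dots> \<le> a / x * B x + \<Omega> x / (x * d x)"
      using main[of x \<rho>] that xd a by (intro add_mono mult_left_mono divide_right_mono) auto
    finally show ?thesis using B'_ge[of x] that by simp
  qed
  have "\<exists>m. ((\<lambda>x. \<phi> (x, \<rho>)) \<longlongrightarrow> m) (at_left x\<^sub>c)" for \<rho>
    by (rule convergent_along_ingoing_lines[OF xi \<phi>_cont \<phi>_der B_der B_lim U_bound])
  then obtain m where m: "\<And>\<rho>. ((\<lambda>x. \<phi> (x, \<rho>)) \<longlongrightarrow> m \<rho>) (at_left x\<^sub>c)" by metis
  \<comment> \<open>The power of \<open>x\<^sub>c - x\<close> enters the exponent of
    \<open>E\<close> with a negative sign and is dropped; the linear term is largest at the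
    horizon.\<close>
  define K where "K = M * exp ((a + 1) / x\<^sub>i * x\<^sub>c)"
  have B_le: "B x \<le> K" if "x \<le> x\<^sub>c" for x
  proof -
    have "(a + 1) / x\<^sub>i * x \<le> (a + 1) / x\<^sub>i * x\<^sub>c" using that a xi by (intro mult_left_mono) auto
    moreover have "0 \<le> N / (x\<^sub>i * c * \<delta>) * (x\<^sub>c - x) powr \<delta>" using N xi c \<delta> by simp
    ultimately show ?thesis unfolding B_def E_def K_def using Mpos by simp
  qed
  have \<phi>_le: "\<bar>\<phi> (x, \<rho>)\<bar> \<le> K" if "x\<^sub>i \<le> x" "x < x\<^sub>c" for x \<rho>
    using main[OF that, of \<rho>] B_le[of x] that by linarith
  have m_le: "\<bar>m \<rho>\<bar> \<le> K" for \<rho>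
  proof (rule tendsto_upperbound[OF tendsto_rabs[OF m]])
    have "\<forall>\<^sub>F x in at_left x\<^sub>c. x\<^sub>i < x \<and> x < x\<^sub>c" using xi by (auto simp: eventually_at_left_field)
    then show "\<forall>\<^sub>F x in at_left x\<^sub>c. \<bar>\<phi> (x, \<rho>)\<bar> \<le> K"
      by eventually_elim (use \<phi>_le in auto)
  qed simp
  define \<Phi> where "\<Phi> = (\<lambda>(x, \<rho>). if x = x\<^sub>c then m \<rho> else \<phi> (x, \<rho>))"
  have "bounded (\<Phi> ` ({x\<^sub>i..x\<^sub>c} \<times> UNIV))"
    unfolding bounded_iff by (rule exI[of _ K]) (auto simp: \<Phi>_def m_le \<phi>_le)
  then show ?thesis
    using m by (intro exI[of _ \<Phi>]) (auto simp: \<Phi>_def)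
qed

end
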